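(* Let $d_1,d_2\ge 1$ and $K\ge 2$ be integers, let $\tau>0$, and let $\theta\in(0,1)^{d_2}$ be such that $f:\mathbb{Z}_K\times(0,1)^{d_2}\to\mathbb{R}$ is $2\tau$-codomain separable using $\theta$. Then for any input $\mathbf{v}\in(0,1)^{d_1}$ with true label $\sigma_{\mathbf{v}}\in\mathbb{Z}_K$, and any $\ell\in\mathbb{R}$ such that $|f(\sigma_{\mathbf{v}},\mathrm{MutNet}_\theta(\mathbf{v}))-\ell|<\tau$, the rule LabelInf, which outputs $\arg\min_{\sigma\in\mathbb{Z}_K}|f(\sigma,\theta)-\ell|$, recovers $\sigma_{\mathbf{v}}$ (that is, $\sigma_{\mathbf{v}}$ is the unique minimizer).
   Context: $\mathbb{Z}_K=\{0,\dots,K-1\}$. For $t>0$, $f:\mathbb{Z}_K\times(0,1)^{d_2}\to\mathbb{R}$ is $t$-codomain separable using $\theta$ if $|f(\sigma_1,\theta)-f(\sigma_2,\theta)|\ge t$ for all distinct $\sigma_1,\sigma_2\in\mathbb{Z}_K$. The network $\mathrm{MutNet}_{\mathbf{x}}$, for a target vector $\mathbf{x}\in(0,1)^{d_2}$, takes inputs in $\mathbb{R}^{d_1}$ and is defined as follows. Fix $M_1\in\mathbb{R}^{d_1\times d_1}$ with all entries negative and an arbitrary $M_2\in\mathbb{R}^{d_1\times d_2}$, and let $\mathbf{x}'\in\mathbb{R}^{d_2}$ have entries $x'_i=\ln\big(x_i/(1-x_i)\big)$. On input $\mathbf{v}$, set $\mathbf{u}_2=\mathrm{ReLU}(\mathbf{v}^\top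 M_1)$ and $\mathbf{u}_3=\mathrm{Sigmoid}(\mathbf{u}_2^\top M_2+\mathbf{x}')$, where $\mathbf{u}_2$ is regarded as a vector in $\mathbb{R}^{d_1}$, and $\mathrm{ReLU}(y)=\max(y,0)$ and $\mathrm{Sigmoid}(y)=(1+e^{-y})^{-1}$ are applied entrywise; the output is $\mathrm{MutNet}_{\mathbf{x}}(\mathbf{v})=\mathbf{u}_3$. *)

theory Defs
  imports "HOL-Analysis.Analysis"
begin

abbreviation label_set :: "nat \<Rightarrow> nat set" where
  "label_set K \<equiv> {0..<K}"

text \<open>Only the values of \<open>f\<close> on \<open>label_set K\<close> and the open unit cube \<open>box 0 1\<close> are meaningful;
  outside that domain the total function \<open>f\<close> is arbitrary.\<close>

definition codomain_separable ::
  "nat \<Rightarrow> (nat \<Rightarrow> real ^ 'd2 \<Rightarrow> real) \<Rightarrow> real \<Rightarrow> real ^ 'd2 \<Rightarrow> bool" where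
  "codomain_separable K f t \<theta> \<longleftrightarrow>
     (\<forall>\<sigma>\<^sub>1\<in>label_set K. \<forall>\<sigma>\<^sub>2\<in>label_set K.
        \<sigma>\<^sub>1 \<noteq> \<sigma>\<^sub>2 \<longrightarrow> \<bar>f \<sigma>\<^sub>1 \<theta> - f \<sigma>\<^sub>2 \<theta>\<bar> \<ge> t)"

definition relu :: "real \<Rightarrow> real" where
  "relu y = max y 0"

definition sigmoid :: "real \<Rightarrow> real" where
  "sigmoid y = inverse (1 + exp (- y))"

text \<open>\<open>real ^ 'n ^ 'm\<close> is the type of matrices with rows indexed by \<open>'m\<close> and columns by \<open>'n\<close>,
  so \<open>M\<^sub>2\<close> below is a \<open>d\<^sub>1 \<times> d\<^sub>2\<close> matrix; \<open>v v* M\<close> is the row vector \<open>v\<close> times \<open>M\<close>.\<close>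

definition mut_net ::
  "real ^ 'd1 ^ 'd1 \<Rightarrow> real ^ 'd2 ^ 'd1 \<Rightarrow> real ^ 'd2 \<Rightarrow> real ^ 'd1 \<Rightarrow> real ^ 'd2" where
  "mut_net M\<^sub>1 M\<^sub>2 x v =
     (let x' = (\<chi> i. ln (x $ i / (1 - x $ i)));
          u\<^sub>2 = (\<chi> i. relu ((v v* M\<^sub>1) $ i));
          u\<^sub>3 = (\<chi> i. sigmoid ((u\<^sub>2 v* M\<^sub>2 + x') $ i))
      in u\<^sub>3)"

text \<open>When the minimizer is not unique, \<open>arg_min_on\<close> makes an unspecified choice.\<close>

definition label_inf ::
  "nat \<Rightarrow> (nat \<Rightarrow> real ^ 'd2 \<Rightarrow> real) \<Rightarrow> real ^ 'd2 \<Rightarrow> real \<Rightarrow> nat" where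
  "label_inf K f \<theta> l = arg_min_on (\<lambda>\<sigma>. \<bar>f \<sigma> \<theta> - l\<bar>) (label_set K)"

end

theory Submission
  imports Defs
begin

text \<open>Positive inputs meet a negative first layer, so ReLU annihilates them and the network returns
  the constant \<open>Sigmoid(x') = x\<close>. With \<open>x = \<theta>\<close>, the observed \<open>l\<close> is within \<open>\<tau>\<close> of \<open>f \<sigma>\<^sub>v \<theta>\<close>, hence by
  separability farther than \<open>\<tau>\<close> from every other label's value.\<close>

text \<open>\<open>exp (- ln (p / (1 - p)))\<close> is \<open>(1 - p) / p\<close>, so the
  denominator of the sigmoid is \<open>1 / p\<close>; the bounds on \<open>p\<close> keep the
  argument of \<open>ln\<close> positive.\<close>

lemma sigmoid_logit:
  assumes "0 < p" "p < 1"
  shows "sigmoid (ln (p / (1 - p))) = p"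
  using assms by (simp add: sigmoid_def exp_minus field_simps)

lemma mut_net_eq:
  fixes M\<^sub>1 :: "real ^ 'd1 ^ 'd1" and M\<^sub>2 :: "real ^ 'd2 ^ 'd1"
  assumes "x \<in> box 0 1" and "\<And>i j. M\<^sub>1 $ i $ j \<le> 0" and "\<And>i. 0 \<le> v $ i"
  shows "mut_net M\<^sub>1 M\<^sub>2 x v = x"
proof -
  have "(v v* M\<^sub>1) $ j \<le> 0" for j
    unfolding vector_matrix_mult_def using assms(2,3)
    by (simp add: sum_nonpos mult_nonneg_nonpos mult_nonpos_nonneg)
  then have "(\<chi> j. relu ((v v* M\<^sub>1) $ j)) = 0"
    by (simp add: relu_def vec_eq_iff)
  \<comment> \<open>A zero hidden layer kills the product with \<open>M\<^sub>2\<close>, so only the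
    logits of \<open>x\<close> reach the sigmoid.\<close>
  then show ?thesis
    using assms(1) by (simp add: mut_net_def sigmoid_logit mem_box_cart)
qed

theorem theorem6:
  fixes K :: nat
    and \<tau> :: real
    and f :: "nat \<Rightarrow> real ^ 'd2 \<Rightarrow> real"
    and \<theta> :: "real ^ 'd2"
    and M\<^sub>1 :: "real ^ 'd1 ^ 'd1"
    and M\<^sub>2 :: "real ^ 'd2 ^ 'd1"
    and v :: "real ^ 'd1"
    and \<sigma>\<^sub>v :: nat
    and l :: real
  assumes "K \<ge> 2"
    and "\<tau> > 0"
    and "\<theta> \<in> box 0 1"
    and "codomain_separable K f (2 * \<tau>) \<theta>"
    and "\<forall>i j. M\<^sub>1 $ i $ j < 0"
    and "v \<in> box 0 1"
    and "\<sigma>\<^sub>v \<in> label_set K"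
    and "\<bar>f \<sigma>\<^sub>v (mut_net M\<^sub>1 M\<^sub>2 \<theta> v) - l\<bar> < \<tau>"
  shows "label_inf K f \<theta> l = \<sigma>\<^sub>v \<and>
         (\<forall>\<sigma>. is_arg_min (\<lambda>\<sigma>. \<bar>f \<sigma> \<theta> - l\<bar>) (\<lambda>\<sigma>. \<sigma> \<in> label_set K) \<sigma> \<longleftrightarrow> \<sigma> = \<sigma>\<^sub>v)"
proof -
  let ?g = "\<lambda>\<sigma>. \<bar>f \<sigma> \<theta> - l\<bar>"
  have "mut_net M\<^sub>1 M\<^sub>2 \<theta> v = \<theta>"
    using assms(3,5,6) by (intro mut_net_eq) (auto simp: mem_box_cart less_imp_le)
  with assms(8) have close: "?g \<sigma>\<^sub>v < \<tau>" by simp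
  have less: "?g \<sigma>\<^sub>v < ?g \<sigma>" if "\<sigma> \<in> label_set K" "\<sigma> \<noteq> \<sigma>\<^sub>v" for \<sigma>
  proof -
    have "2 * \<tau> \<le> \<bar>f \<sigma> \<theta> - f \<sigma>\<^sub>v \<theta>\<bar>"
      using assms(4,7) that unfolding codomain_separable_def by blast
    \<comment> \<open>Triangle inequality:
      \<open>?g \<sigma> \<ge> 2 * \<tau> - ?g \<sigma>\<^sub>v > \<tau>\<close>.\<close>
    with close show ?thesis by linarith
  qed
  have "is_arg_min ?g (\<lambda>\<sigma>. \<sigma> \<in> label_set K) \<sigma> \<longleftrightarrow> \<sigma> = \<sigma>\<^sub>v" for \<sigma>
    using less assms(7) unfolding is_arg_min_def by (metis less_asym less_irrefl)
  \<comment> \<open>\<open>arg_min\<close> is a Hilbert choice; its predicate now reads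
    \<open>\<sigma> = \<sigma>\<^sub>v\<close>, which leaves one possible value.\<close>
  then show ?thesis
    by (simp add: label_inf_def arg_min_on_def arg_min_def)
qed

end
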